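(* Let $\alpha\in\mathbb{C}\setminus\{1\}$ and $a_{12},a_{23}\in\mathbb{C}$. Let $r_1=a_{12}(e_1\otimes e_2-e_2\otimes e_1)$, $r_2=a_{23}(e_2\otimes e_3-e_3\otimes e_2)$, and for $t\in\{1,2\}$ let $\circ$ be the associative product on $\mathcal{H}_\alpha^*$ dual to $\Delta_t(x)=(\mathrm{id}\otimes L(x)-R(x)\otimes\mathrm{id})r_t$. Then there is a double construction of a symmetric Frobenius algebra $(\mathcal{H}_\alpha\bowtie\mathcal{H}_\alpha^*,\mathcal{B})$ associated to $(\mathcal{H}_\alpha,\cdot)$ and $(\mathcal{H}_\alpha^*,\circ)$, where $\mathcal{B}(x+a^*,y+b^* )=\langle x,b^*\rangle+\langle a^*,y\rangle$, with product on $\mathcal{H}_\alpha\oplus\mathcal{H}_\alpha^*$ $$(x+a^* )\ast(y+b^* )=\big(x\cdot y+R^*_\circ(a^* )y+L^*_\circ(b^* )x\big)+\big(a^*\circ b^*+R^*_\cdot(x)b^*+L^*_\cdot(y)a^*\big).$$ Explicitly, the products of basis vectors are as follows (unlisted products are zero). For $t=1$: $$e_1\ast e_3=e_2,\quad e_3\ast e_1=\alpha e_2,\quad e_2^*\ast e_1=e_3^*,\quad e_1\ast e_2^*=\alpha e_3^*,\quad e_2^*\ast e_2^*=-(1+\alpha)a_{12}e_3^*,$$ $$e_3\ast e_2^*=e_1^*-(\alpha+1)a_{12}e_2,\quad e_2^*\ast e_3=\alpha e_1^*-(\alpha+1)a_{12}e_2 .$$ For $t=2$: $$e_1\ast e_3=e_2,\quad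 e_3\ast e_1=\alpha e_2,\quad e_3\ast e_2^*=e_1^*,\quad e_2^*\ast e_3=\alpha e_1^*,\quad e_2^*\ast e_2^*=(1+\alpha)a_{23}e_1^*,$$ $$e_1\ast e_2^*=\alpha e_3^*+(1+\alpha)a_{23}e_2,\quad e_2^*\ast e_1=e_3^*+(1+\alpha)a_{23}e_2 .$$
   Context: $\mathcal{H}_\alpha$ is the complex associative algebra with basis $e_1,e_2,e_3$ and product $e_1\cdot e_3=e_2$, $e_3\cdot e_1=\alpha e_2$, all other products of basis vectors zero; $e_1^*,e_2^*,e_3^*$ is the dual basis of $\mathcal{H}_\alpha^*$. $L(x)y=x\cdot y$, $R(x)y=y\cdot x$. The product dual to $\Delta_t$ is $\langle a^*\circ b^*,x\rangle=\langle a^*\otimes b^*,\Delta_t(x)\rangle$. The dual maps are $(L^*_\cdot(x)u^* )(v)=u^*(x\cdot v)$, $(R^*_\cdot(x)u^* )(v)=u^*(v\cdot x)$, and $\langle L^*_\circ(a^* )x,b^*\rangle=\langle x,a^*\circ b^*\rangle$, $\langle R^*_\circ(a^* )x,b^*\rangle=\langle x,b^*\circ a^*\rangle$. A double construction of a symmetric Frobenius algebra associated to associative algebras $\mathcal{A}_1$ and $\mathcal{A}_1^*$ (the latter a product on the dual space of $\mathcal{A}_1$) is an associative algebra $\mathcal{A}=\mathcal{A}_1\oplus\mathcal{A}_1^*$ (direct sum of vector spaces) containing $\mathcal{A}_1$ and $\mathcal{A}_1^*$ as subalgebras, such that the natural nondegenerate symmetric bilinear form $\mathcal{B}(x+a^*,y+b^*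 )=\langle x,b^*\rangle+\langle a^*,y\rangle$ is invariant: $\mathcal{B}(u\ast v,w)=\mathcal{B}(u,v\ast w)$ for all $u,v,w\in\mathcal{A}$. *)

theory Defs
  imports "HOL-Analysis.Analysis"
begin

(* In the index type 3 the numeral 3 equals 0, so the indices of complex^3 are 1, 2, 3,
   pairwise distinct (see UNIV_3). *)

abbreviation ebasis :: "'n::finite \<Rightarrow> complex^'n" where
  "ebasis i \<equiv> axis i 1"

text \<open>The algebraic dual of the space \<open>complex^'n\<close>. (The library type of bounded linear
  functions only records real linearity.)\<close>

typedef 'n cdual =
  "{f :: complex^'n::finite \<Rightarrow> complex. Vector_Spaces.linear (*s) (*) f}"
  morphisms dapp Abs_cdual
  by (rule exI[of _ "\<lambda>_. 0"]) (auto intro!: Vector_Spaces.linear.intro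
      simp: vec.vector_space_axioms vector_space_over_itself.vector_space_axioms
        vec.module_axioms vector_space_over_itself.module_axioms
        module_hom_def module_hom_axioms_def)

setup_lifting type_definition_cdual

lemma linear_dual_iff:
  "Vector_Spaces.linear (*s) (*) f \<longleftrightarrow>
    (\<forall>x y. f (x + y) = f x + f y) \<and> (\<forall>c x. f (c *s x) = c * f x)"
  for f :: "complex^'n::finite \<Rightarrow> complex"
  by (auto simp: Vector_Spaces.linear_def module_hom_def module_hom_axioms_def
      vec.vector_space_axioms vector_space_over_itself.vector_space_axioms
      vec.module_axioms vector_space_over_itself.module_axioms)

instantiation cdual :: (finite) ab_group_add
begin

lift_definition zero_cdual :: "'a cdual" is "\<lambda>_. 0"
  by (simp add: linear_dual_iff)
lift_definition plus_cdual :: "'a cdual \<Rightarrow> 'a cdual \<Rightarrow> 'a cdual" is "\<lambda>f g x. f x + g x"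
  by (simp add: linear_dual_iff algebra_simps)
lift_definition uminus_cdual :: "'a cdual \<Rightarrow> 'a cdual" is "\<lambda>f x. - f x"
  by (simp add: linear_dual_iff)
lift_definition minus_cdual :: "'a cdual \<Rightarrow> 'a cdual \<Rightarrow> 'a cdual" is "\<lambda>f g x. f x - g x"
  by (simp add: linear_dual_iff algebra_simps)

instance
  by standard (transfer; simp add: fun_eq_iff)+

end

lift_definition dscale :: "complex \<Rightarrow> 'n::finite cdual \<Rightarrow> 'n cdual" is "\<lambda>c f x. c * f x"
  by (simp add: linear_dual_iff algebra_simps)

lift_definition dbasis :: "'n::finite \<Rightarrow> 'n cdual" is "\<lambda>i x. x $ i"
  by (simp add: linear_dual_iff)

lemma dapp_dbasis_ebasis: "dapp (dbasis i) (ebasis j) = (if i = j then 1 else 0)"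
  by transfer (simp add: axis_def)


section \<open>Tensors\<close>

text \<open>The tensor square of \<open>complex^'n\<close> is \<open>complex^('n \<times> 'n)\<close>, the coordinate \<open>(i, j)\<close>
  being the coefficient of \<open>ebasis i \<otimes> ebasis j\<close>.\<close>

definition tensor :: "complex^'n::finite \<Rightarrow> complex^'n \<Rightarrow> complex^('n \<times> 'n)"  (infixr "\<otimes>\<^sub>t" 75)
  where "x \<otimes>\<^sub>t y = (\<chi> p. x $ fst p * y $ snd p)"

definition tensor_map ::
  "(complex^'n::finite \<Rightarrow> complex^'n) \<Rightarrow> (complex^'n \<Rightarrow> complex^'n)
    \<Rightarrow> complex^('n \<times> 'n) \<Rightarrow> complex^('n \<times> 'n)"
  where "tensor_map f g T = (\<Sum>i\<in>UNIV. \<Sum>j\<in>UNIV. T $ (i, j) *s (f (ebasis i) \<otimes>\<^sub>t g (ebasis j)))"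

definition tensor_pairing :: "'n::finite cdual \<Rightarrow> 'n cdual \<Rightarrow> complex^('n \<times> 'n) \<Rightarrow> complex"
  where "tensor_pairing a b T =
    (\<Sum>i\<in>UNIV. \<Sum>j\<in>UNIV. T $ (i, j) * (dapp a (ebasis i) * dapp b (ebasis j)))"

lemma dapp_eq_sum: "dapp a x = (\<Sum>i\<in>UNIV. x $ i * dapp a (ebasis i))"
proof -
  have lin: "dapp a (u + v) = dapp a u + dapp a v" "dapp a (c *s u) = c * dapp a u"
    "dapp a 0 = 0" for u v c
    using dapp[of a] by (auto simp: linear_dual_iff)
      (metis add_cancel_left_left)
  have "dapp a (sum h A) = (\<Sum>i\<in>A. dapp a (h i))" if "finite A" for h and A :: "'a set"
    using that by induction (auto simp: lin)
  then show ?thesis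
    by (subst (1) basis_expansion[of x, symmetric]) (simp add: lin)
qed

lemma tensor_pairing_tensor: "tensor_pairing a b (x \<otimes>\<^sub>t y) = dapp a x * dapp b y"
  unfolding dapp_eq_sum[of a x] dapp_eq_sum[of b y]
  by (simp add: tensor_pairing_def tensor_def sum_product mult_ac)

lemma tensor_map_tensor:
  assumes f: "Vector_Spaces.linear (*s) (*s) f" and g: "Vector_Spaces.linear (*s) (*s) g"
  shows "tensor_map f g (x \<otimes>\<^sub>t y) = f x \<otimes>\<^sub>t g y"
proof -
  have exp: "h z = (\<Sum>i\<in>UNIV. z $ i *s h (ebasis i))"
    if "Vector_Spaces.linear (*s) (*s) h" for h :: "complex^'n \<Rightarrow> complex^'n" and z
  proof -
    have "h z = h (\<Sum>i\<in>UNIV. z $ i *s ebasis i)"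
      by (simp add: basis_expansion)
    also have "\<dots> = (\<Sum>i\<in>UNIV. z $ i *s h (ebasis i))"
      by (simp add: vec.linear_sum[OF that] vec.linear_scale[OF that])
    finally show ?thesis .
  qed
  have "f x $ k * g y $ l =
      (\<Sum>i\<in>UNIV. \<Sum>j\<in>UNIV. x $ i * y $ j * (f (ebasis i) $ k * g (ebasis j) $ l))" for k l
    unfolding exp[OF f, of x] exp[OF g, of y]
    by (simp add: sum_product mult_ac)
  then show ?thesis
    by (simp add: vec_eq_iff tensor_map_def tensor_def)
qed


section \<open>Algebras, dual maps and double constructions\<close>

definition bilinear_product :: "(complex \<Rightarrow> 'v::ab_group_add \<Rightarrow> 'v) \<Rightarrow> ('v \<Rightarrow> 'v \<Rightarrow> 'v) \<Rightarrow> bool"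
  where "bilinear_product s m \<longleftrightarrow>
    (\<forall>x. Vector_Spaces.linear s s (m x)) \<and> (\<forall>y. Vector_Spaces.linear s s (\<lambda>x. m x y))"

text \<open>Algebras are not required to have a unit.\<close>

definition assoc_algebra :: "(complex \<Rightarrow> 'v::ab_group_add \<Rightarrow> 'v) \<Rightarrow> ('v \<Rightarrow> 'v \<Rightarrow> 'v) \<Rightarrow> bool"
  where "assoc_algebra s m \<longleftrightarrow>
    vector_space s \<and> bilinear_product s m \<and> (\<forall>x y z. m (m x y) z = m x (m y z))"

definition symmetric_frobenius_algebra ::
  "(complex \<Rightarrow> 'v::ab_group_add \<Rightarrow> 'v) \<Rightarrow> ('v \<Rightarrow> 'v \<Rightarrow> 'v) \<Rightarrow> ('v \<Rightarrow> 'v \<Rightarrow> complex) \<Rightarrow> bool"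
  where "symmetric_frobenius_algebra s m B \<longleftrightarrow>
    assoc_algebra s m \<and>
    (\<forall>u. Vector_Spaces.linear s (*) (B u)) \<and>
    (\<forall>v. Vector_Spaces.linear s (*) (\<lambda>u. B u v)) \<and>
    (\<forall>u v. B u v = B v u) \<and>
    (\<forall>u. (\<forall>v. B u v = 0) \<longrightarrow> u = 0) \<and>
    (\<forall>u v w. B (m u v) w = B u (m v w))"

definition Lmul :: "('v \<Rightarrow> 'v \<Rightarrow> 'v) \<Rightarrow> 'v \<Rightarrow> 'v \<Rightarrow> 'v"
  where "Lmul m x y = m x y"

definition Rmul :: "('v \<Rightarrow> 'v \<Rightarrow> 'v) \<Rightarrow> 'v \<Rightarrow> 'v \<Rightarrow> 'v"
  where "Rmul m x y = m y x"

text \<open>The duals of \<open>Lmul m x\<close> and \<open>Rmul m x\<close> for a product \<open>m\<close> on \<open>complex^'n\<close>;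
  \<open>Abs_cdual\<close> is applied to a linear function whenever \<open>m\<close> is bilinear.\<close>

definition Ldual :: "(complex^'n::finite \<Rightarrow> complex^'n \<Rightarrow> complex^'n) \<Rightarrow> complex^'n \<Rightarrow> 'n cdual \<Rightarrow> 'n cdual"
  where "Ldual m x u = Abs_cdual (\<lambda>v. dapp u (m x v))"

definition Rdual :: "(complex^'n::finite \<Rightarrow> complex^'n \<Rightarrow> complex^'n) \<Rightarrow> complex^'n \<Rightarrow> 'n cdual \<Rightarrow> 'n cdual"
  where "Rdual m x u = Abs_cdual (\<lambda>v. dapp u (m v x))"

text \<open>The duals of left and right multiplication for a product on the dual space, as maps of
  \<open>complex^'n\<close> (identified with its bidual).\<close>

definition Lcodual :: "('n::finite cdual \<Rightarrow> 'n cdual \<Rightarrow> 'n cdual) \<Rightarrow> 'n cdual \<Rightarrow> complex^'n \<Rightarrow> complex^'n"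
  where "Lcodual circ a x = (THE y. \<forall>b. dapp b y = dapp (circ a b) x)"

definition Rcodual :: "('n::finite cdual \<Rightarrow> 'n cdual \<Rightarrow> 'n cdual) \<Rightarrow> 'n cdual \<Rightarrow> complex^'n \<Rightarrow> complex^'n"
  where "Rcodual circ a x = (THE y. \<forall>b. dapp b y = dapp (circ b a) x)"

definition coproduct ::
  "(complex^'n::finite \<Rightarrow> complex^'n \<Rightarrow> complex^'n) \<Rightarrow> complex^('n \<times> 'n) \<Rightarrow> complex^'n \<Rightarrow> complex^('n \<times> 'n)"
  where "coproduct m r x = tensor_map id (Lmul m x) r - tensor_map (Rmul m x) id r"

definition dual_product :: "(complex^'n::finite \<Rightarrow> complex^('n \<times> 'n)) \<Rightarrow> 'n cdual \<Rightarrow> 'n cdual \<Rightarrow> 'n cdual"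
  where "dual_product \<Delta> a b = Abs_cdual (\<lambda>x. tensor_pairing a b (\<Delta> x))"

lemma dapp_Abs_cdual: "Vector_Spaces.linear (*s) (*) f \<Longrightarrow> dapp (Abs_cdual f) = f"
  by (simp add: Abs_cdual_inverse)

lemma linear_dapp: "Vector_Spaces.linear (*s) (*) (dapp a)"
  using dapp[of a] by simp

lemma linear_dapp_comp:
  assumes "Vector_Spaces.linear (*s) (*s) f"
  shows "Vector_Spaces.linear (*s) (*) (\<lambda>v. dapp u (f v))"
  using Vector_Spaces.linear_compose[OF assms linear_dapp[of u]] by (simp add: comp_def)

lemma dapp_Ldual:
  assumes "bilinear_product (*s) m"
  shows "dapp (Ldual m x u) v = dapp u (m x v)"
  using assms by (simp add: Ldual_def bilinear_product_def dapp_Abs_cdual linear_dapp_comp)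

lemma dapp_Rdual:
  assumes "bilinear_product (*s) m"
  shows "dapp (Rdual m x u) v = dapp u (m v x)"
  using assms by (simp add: Rdual_def bilinear_product_def dapp_Abs_cdual linear_dapp_comp)

lemma dapp_add [simp]: "dapp (a + b) x = dapp a x + dapp b x"
  by transfer simp

lemma dapp_zero [simp]: "dapp 0 x = 0"
  by transfer simp

lemma dapp_dscale [simp]: "dapp (dscale c a) x = c * dapp a x"
  by transfer simp

lemma dapp_dbasis [simp]: "dapp (dbasis i) x = x $ i"
  by transfer simp

lemma cdual_eqI: "(\<And>x. dapp a x = dapp b x) \<Longrightarrow> a = b"
  by transfer auto

lemma bidual_ex1:
  assumes "Vector_Spaces.linear dscale (*) \<phi>"
  shows "\<exists>!y. \<forall>b. dapp b y = \<phi> b"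
proof (rule ex1I)
  have add: "\<phi> (a + b) = \<phi> a + \<phi> b" and scale: "\<phi> (dscale c a) = c * \<phi> a" for a b c
    using assms by (auto simp: Vector_Spaces.linear_def module_hom_def module_hom_axioms_def)
  have zero: "\<phi> 0 = 0"
    using add[of 0 0] by simp
  have sum: "\<phi> (sum h A) = (\<Sum>i\<in>A. \<phi> (h i))" "dapp (sum h A) x = (\<Sum>i\<in>A. dapp (h i) x)"
    if "finite A" for h x and A :: "'a set"
    using that by (induction, simp_all add: add zero)
  have exp: "b = (\<Sum>i\<in>UNIV. dscale (dapp b (ebasis i)) (dbasis i))" for b :: "'a cdual"
  proof (rule cdual_eqI)
    fix x
    show "dapp b x = dapp (\<Sum>i\<in>UNIV. dscale (dapp b (ebasis i)) (dbasis i)) x"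
      unfolding dapp_eq_sum[of b x] by (simp add: sum mult.commute)
  qed
  show "\<forall>b. dapp b (\<chi> i. \<phi> (dbasis i)) = \<phi> b"
  proof
    fix b :: "'a cdual"
    have "\<phi> b = \<phi> (\<Sum>i\<in>UNIV. dscale (dapp b (ebasis i)) (dbasis i))"
      using exp[of b] by simp
    also have "\<dots> = (\<Sum>i\<in>UNIV. dapp b (ebasis i) * \<phi> (dbasis i))"
      by (simp add: sum scale)
    also have "\<dots> = dapp b (\<chi> i. \<phi> (dbasis i))"
      unfolding dapp_eq_sum[of b "\<chi> i. \<phi> (dbasis i)"] by (simp add: mult.commute)
    finally show "dapp b (\<chi> i. \<phi> (dbasis i)) = \<phi> b" ..
  qed
  show "y = (\<chi> i. \<phi> (dbasis i))" if "\<forall>b. dapp b y = \<phi> b" for y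
    using that by (metis (no_types, lifting) dapp_dbasis vec_eq_iff vec_lambda_beta)
qed

lemma linear_dapp_left:
  assumes "Vector_Spaces.linear dscale dscale f"
  shows "Vector_Spaces.linear dscale (*) (\<lambda>b. dapp (f b) x)"
  using assms
  by (auto simp: Vector_Spaces.linear_def module_hom_def module_hom_axioms_def
      vector_space_over_itself.vector_space_axioms vector_space_over_itself.module_axioms)

lemma dapp_Lcodual:
  assumes "bilinear_product dscale circ"
  shows "dapp b (Lcodual circ a x) = dapp (circ a b) x"
proof -
  have "Vector_Spaces.linear dscale (*) (\<lambda>b. dapp (circ a b) x)"
    using assms by (intro linear_dapp_left) (simp add: bilinear_product_def)
  from theI'[OF bidual_ex1[OF this]] show ?thesis
    by (simp add: Lcodual_def)
qed

lemma dapp_Rcodual: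
  assumes "bilinear_product dscale circ"
  shows "dapp b (Rcodual circ a x) = dapp (circ b a) x"
proof -
  have "Vector_Spaces.linear dscale (*) (\<lambda>b. dapp (circ b a) x)"
    using assms by (intro linear_dapp_left[of "\<lambda>b. circ b a"]) (simp add: bilinear_product_def)
  from theI'[OF bidual_ex1[OF this]] show ?thesis
    by (simp add: Rcodual_def)
qed

lemma dapp_dual_product:
  assumes "Vector_Spaces.linear (*s) (*s) \<Delta>"
  shows "dapp (dual_product \<Delta> a b) x = tensor_pairing a b (\<Delta> x)"
proof -
  have "Vector_Spaces.linear (*s) (*) (\<lambda>x. tensor_pairing a b (\<Delta> x))"
    by (simp add: linear_dual_iff tensor_pairing_def vec.linear_add[OF assms]
        vec.linear_scale[OF assms] sum.distrib sum_distrib_left algebra_simps)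
  then show ?thesis
    by (simp add: dual_product_def dapp_Abs_cdual)
qed

lemma linear_coproduct:
  assumes "bilinear_product (*s) m"
  shows "Vector_Spaces.linear (*s) (*s) (coproduct m r)"
proof -
  have "m (x + y) z = m x z + m y z" "m z (x + y) = m z x + m z y"
    "m (c *s x) z = c *s m x z" "m z (c *s x) = c *s m z x" for x y z c
    using assms
    by (auto simp: bilinear_product_def Vector_Spaces.linear_def module_hom_def
        module_hom_axioms_def)
  note m = this
  have add: "coproduct m r (x + y) $ p = coproduct m r x $ p + coproduct m r y $ p" for x y p
    by (simp add: coproduct_def tensor_map_def tensor_def Lmul_def Rmul_def m sum.distrib
        distrib_left distrib_right)
  have smul: "coproduct m r (c *s x) $ p = c * coproduct m r x $ p" for c x p
    by (simp add: coproduct_def tensor_map_def tensor_def Lmul_def Rmul_def m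
        sum_distrib_left right_diff_distrib mult_ac)
  show ?thesis
    by (simp add: Vector_Spaces.linear_def module_hom_def module_hom_axioms_def
        vec.vector_space_axioms vec.module_axioms vec_eq_iff add smul)
qed

definition sum_scale :: "complex \<Rightarrow> (complex^'n::finite) \<times> 'n cdual \<Rightarrow> (complex^'n) \<times> 'n cdual"
    (infixr "\<cdot>" 75)
  where "c \<cdot> u = (c *s fst u, dscale c (snd u))"

definition natural_form :: "(complex^'n::finite) \<times> 'n cdual \<Rightarrow> (complex^'n) \<times> 'n cdual \<Rightarrow> complex"
  where "natural_form = (\<lambda>(x, a) (y, b). dapp b x + dapp a y)"

definition double_construction ::
  "(complex^'n::finite \<Rightarrow> complex^'n \<Rightarrow> complex^'n) \<Rightarrow> ('n cdual \<Rightarrow> 'n cdual \<Rightarrow> 'n cdual)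
    \<Rightarrow> ((complex^'n) \<times> 'n cdual \<Rightarrow> (complex^'n) \<times> 'n cdual \<Rightarrow> (complex^'n) \<times> 'n cdual) \<Rightarrow> bool"
  where "double_construction m circ prd \<longleftrightarrow>
    assoc_algebra (*s) m \<and> assoc_algebra dscale circ \<and>
    symmetric_frobenius_algebra sum_scale prd natural_form \<and>
    (\<forall>x y. prd (x, 0) (y, 0) = (m x y, 0)) \<and>
    (\<forall>a b. prd (0, a) (0, b) = (0, circ a b))"

definition bowtie_product ::
  "(complex^'n::finite \<Rightarrow> complex^'n \<Rightarrow> complex^'n) \<Rightarrow> ('n cdual \<Rightarrow> 'n cdual \<Rightarrow> 'n cdual)
    \<Rightarrow> (complex^'n) \<times> 'n cdual \<Rightarrow> (complex^'n) \<times> 'n cdual \<Rightarrow> (complex^'n) \<times> 'n cdual"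
  where "bowtie_product m circ = (\<lambda>(x, a) (y, b).
    (m x y + Rcodual circ a y + Lcodual circ b x,
     circ a b + Rdual m x b + Ldual m y a))"


section \<open>The algebra and its coproducts\<close>

text \<open>The bilinear extension of the defining products on the basis (see \<open>hprod_ebasis\<close>).\<close>

definition hprod :: "complex \<Rightarrow> complex^3 \<Rightarrow> complex^3 \<Rightarrow> complex^3"
  where "hprod \<alpha> x y = (x $ 1 * y $ 3 + \<alpha> * (x $ 3 * y $ 1)) *s ebasis 2"

lemma hprod_ebasis:
  "hprod \<alpha> (ebasis i) (ebasis j) =
    (if i = 1 \<and> j = 3 then ebasis 2 else if i = 3 \<and> j = 1 then \<alpha> *s ebasis 2 else 0)"
  by (auto simp: hprod_def axis_def)

definition r1 :: "complex \<Rightarrow> complex^(3 \<times> 3)"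
  where "r1 a12 = a12 *s (ebasis 1 \<otimes>\<^sub>t ebasis 2 - ebasis 2 \<otimes>\<^sub>t ebasis 1)"

definition r2 :: "complex \<Rightarrow> complex^(3 \<times> 3)"
  where "r2 a23 = a23 *s (ebasis 2 \<otimes>\<^sub>t ebasis 3 - ebasis 3 \<otimes>\<^sub>t ebasis 2)"

definition hcirc :: "complex \<Rightarrow> complex^(3 \<times> 3) \<Rightarrow> 3 cdual \<Rightarrow> 3 cdual \<Rightarrow> 3 cdual"
  where "hcirc \<alpha> r = dual_product (coproduct (hprod \<alpha>) r)"

definition hbowtie :: "complex \<Rightarrow> complex^(3 \<times> 3)
    \<Rightarrow> (complex^3) \<times> 3 cdual \<Rightarrow> (complex^3) \<times> 3 cdual \<Rightarrow> (complex^3) \<times> 3 cdual"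
  where "hbowtie \<alpha> r = bowtie_product (hprod \<alpha>) (hcirc \<alpha> r)"

definition E :: "3 \<Rightarrow> (complex^3) \<times> 3 cdual"
  where "E i = (ebasis i, 0)"

definition Es :: "3 \<Rightarrow> (complex^3) \<times> 3 cdual"
  where "Es i = (0, dbasis i)"

text \<open>All products of vectors of \<open>S\<close> are those listed, the unlisted ones being zero.\<close>

definition has_product_table :: "'v set \<Rightarrow> ('v \<Rightarrow> 'v \<Rightarrow> 'v::zero) \<Rightarrow> (('v \<times> 'v) \<times> 'v) list \<Rightarrow> bool"
  where "has_product_table S m entries \<longleftrightarrow>
    (\<forall>u\<in>S. \<forall>v\<in>S. m u v = (case map_of entries (u, v) of Some w \<Rightarrow> w | None \<Rightarrow> 0))"

end

theory Submission
  imports Defs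
begin

text \<open>Invariance of the natural form under the bowtie product holds for any two bilinear products, by
  the very definition of the dual maps; only associativity depends on the algebra. For both
  tensors the coproduct has the form \<open>x \<mapsto> k x\<^sub>j e\<^sub>2 \<otimes> e\<^sub>2\<close> with \<open>j \<noteq> 2\<close>. Every product then lies in the
  span of \<open>e\<^sub>2, e\<^sub>1\<^sup>*, e\<^sub>3\<^sup>*\<close>, which annihilates the whole algebra on both sides, so all triple
  products vanish.\<close>

lemma bilinear_product_iff:
  "bilinear_product s m \<longleftrightarrow> vector_space s \<and>
    (\<forall>x y z. m (x + y) z = m x z + m y z) \<and> (\<forall>x y z. m x (y + z) = m x y + m x z) \<and>
    (\<forall>c x y. m (s c x) y = s c (m x y)) \<and> (\<forall>c x y. m x (s c y) = s c (m x y))"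
  unfolding bilinear_product_def Vector_Spaces.linear_def module_hom_def module_hom_axioms_def
  by (auto dest: module_iff_vector_space[THEN iffD2] simp: module_iff_vector_space)

lemma dapp_vec_add [simp]: "dapp a (x + y) = dapp a x + dapp a y"
  and dapp_vec_scale [simp]: "dapp a (c *s x) = c * dapp a x"
  using dapp[of a] by (auto simp: linear_dual_iff)

lemma dapp_vec_zero [simp]: "dapp a 0 = 0"
  using dapp_vec_add[of a 0 0] by simp

text \<open>The coordinate functionals \<open>dbasis i\<close> already separate points. Since
  \<open>Lcodual\<close> and \<open>Rcodual\<close> are known only through their pairings with
  functionals, vector identities involving them are proved this way.\<close>

lemma vec_eq_dappI: "(\<And>b. dapp b x = dapp b y) \<Longrightarrow> x = y"
  by (metis dapp_dbasis vec_eq_iff)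

lemma vector_space_dscale: "vector_space dscale"
  by unfold_locales (auto intro!: cdual_eqI simp: algebra_simps)

lemma vector_space_sum_scale: "vector_space sum_scale"
  by unfold_locales (auto intro!: cdual_eqI simp: sum_scale_def prod_eq_iff vec_eq_iff algebra_simps)

context
  fixes m :: "complex^'n::finite \<Rightarrow> complex^'n \<Rightarrow> complex^'n"
    and circ :: "'n cdual \<Rightarrow> 'n cdual \<Rightarrow> 'n cdual"
  assumes m: "bilinear_product (*s) m" and circ: "bilinear_product dscale circ"
begin

lemma bilinear_bowtie_product: "bilinear_product sum_scale (bowtie_product m circ)"
  using m circ
  by (auto simp: bilinear_product_iff vector_space_sum_scale bowtie_product_def sum_scale_def
      dapp_Rcodual[OF circ] dapp_Lcodual[OF circ] dapp_Rdual[OF m] dapp_Ldual[OF m] distrib_left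
      intro!: vec_eq_dappI cdual_eqI)

text \<open>For components (x, a), (y, b), (z, c), moving every dual map across the pairing turns
  both sides into the same six terms: the cyclic permutations of c(x y) and of (a b)(z), where the
  product of functionals is \<open>circ\<close>.\<close>

lemma natural_form_bowtie_product:
  "natural_form (bowtie_product m circ u v) w = natural_form u (bowtie_product m circ v w)"
  by (cases u; cases v; cases w)
    (simp add: natural_form_def bowtie_product_def dapp_Rcodual[OF circ] dapp_Lcodual[OF circ]
      dapp_Rdual[OF m] dapp_Ldual[OF m])

lemma bowtie_product_inl: "bowtie_product m circ (x, 0) (y, 0) = (m x y, 0)"
proof -
  \<comment> \<open>With both functionals zero, \<open>Rcodual\<close> and \<open>Lcodual\<close>
    pair to products having a factor 0, so the mixed terms vanish.\<close>
  have "circ 0 a = 0" "circ a 0 = 0" for a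
    using circ by (metis add_cancel_left_left bilinear_product_iff)+
  then show ?thesis
    by (auto simp: bowtie_product_def dapp_Rcodual[OF circ] dapp_Lcodual[OF circ]
        dapp_Rdual[OF m] dapp_Ldual[OF m] intro!: vec_eq_dappI cdual_eqI)
qed

lemma bowtie_product_inr: "bowtie_product m circ (0, a) (0, b) = (0, circ a b)"
proof -
  have "m 0 x = 0" "m x 0 = 0" for x
    using m by (metis add_cancel_left_left bilinear_product_iff)+
  then show ?thesis
    by (auto simp: bowtie_product_def dapp_Rcodual[OF circ] dapp_Lcodual[OF circ]
        dapp_Rdual[OF m] dapp_Ldual[OF m] intro!: vec_eq_dappI cdual_eqI)
qed

end

lemma linear_natural_form:
  "Vector_Spaces.linear sum_scale (*) (natural_form u)"
  "Vector_Spaces.linear sum_scale (*) (\<lambda>u. natural_form u v)"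
  by (auto simp: Vector_Spaces.linear_def module_hom_def module_hom_axioms_def
      vector_space_sum_scale module_iff_vector_space vector_space_over_itself.vector_space_axioms
      natural_form_def sum_scale_def algebra_simps split: prod.splits)

lemma natural_form_commute: "natural_form u v = natural_form v u"
  by (auto simp: natural_form_def split: prod.splits)

lemma natural_form_nondegenerate:
  assumes "\<And>v. natural_form u v = 0"
  shows "u = 0"
proof -
  obtain x a where u: "u = (x, a)" by (cases u)
  \<comment> \<open>Pure functionals detect the vector part, pure vectors the functional
    part.\<close>
  have "x = 0" using assms[of "(0, b)" for b] by (intro vec_eq_dappI) (simp add: u natural_form_def)
  moreover have "a = 0" using assms[of "(y, 0)" for y]
    by (intro cdual_eqI) (simp add: u natural_form_def)
  ultimately show ?thesis by (simp add: u zero_prod_def)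
qed

lemma double_construction_bowtie_product:
  assumes "assoc_algebra (*s) m" "assoc_algebra dscale circ"
    and "\<And>u v w. bowtie_product m circ (bowtie_product m circ u v) w =
      bowtie_product m circ u (bowtie_product m circ v w)"
  shows "double_construction m circ (bowtie_product m circ)"
proof -
  have bil: "bilinear_product (*s) m" "bilinear_product dscale circ"
    using assms by (auto simp: assoc_algebra_def)
  show ?thesis
    unfolding double_construction_def symmetric_frobenius_algebra_def assoc_algebra_def[of sum_scale]
    using assms linear_natural_form natural_form_commute natural_form_nondegenerate
      vector_space_sum_scale bilinear_bowtie_product[OF bil] natural_form_bowtie_product[OF bil]
      bowtie_product_inl[OF bil] bowtie_product_inr[OF bil]
    by blast
qed

lemma bilinear_hprod: "bilinear_product (*s) (hprod \<alpha>)"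
  by (auto simp: bilinear_product_iff vec.vector_space_axioms hprod_def vec_eq_iff algebra_simps)

lemma assoc_algebra_hprod: "assoc_algebra (*s) (hprod \<alpha>)"
  by (auto simp: assoc_algebra_def bilinear_hprod vec.vector_space_axioms hprod_def vec_eq_iff axis_def)

text \<open>Pairing a \<otimes> b with \<open>ebasis 2 \<otimes>\<^sub>t ebasis 2\<close> gives the
  product of the values of a and b at \<open>ebasis 2\<close>; the remaining factor
  \<open>x $ j\<close> is the functional \<open>dbasis j\<close>.\<close>

lemma hcirc_eq:
  assumes "\<And>x. coproduct (hprod \<alpha>) r x = (k * x $ j) *s (ebasis 2 \<otimes>\<^sub>t ebasis 2)"
  shows "hcirc \<alpha> r a b = dscale (k * (dapp a (ebasis 2) * dapp b (ebasis 2))) (dbasis j)"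
proof (rule cdual_eqI)
  fix x
  have "tensor_pairing a b (c *s T) = c * tensor_pairing a b T" for c T
    by (simp add: tensor_pairing_def sum_distrib_left mult_ac)
  then show "dapp (hcirc \<alpha> r a b) x =
      dapp (dscale (k * (dapp a (ebasis 2) * dapp b (ebasis 2))) (dbasis j)) x"
    by (simp add: hcirc_def dapp_dual_product[OF linear_coproduct[OF bilinear_hprod]] assms
        tensor_pairing_tensor)
qed

text \<open>As \<open>ebasis 2\<close> annihilates the algebra, only \<open>ebasis 1\<close>
  contributes: left multiplication by x sends it to \<open>\<alpha> * x $ 3\<close> times
  \<open>ebasis 2\<close>, right multiplication to \<open>x $ 3\<close> times
  \<open>ebasis 2\<close>. Antisymmetry of the tensor makes the two add up to the factor
  \<open>1 + \<alpha>\<close>.\<close>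

lemma coproduct_r1:
  "coproduct (hprod \<alpha>) (r1 a) x = ((- (1 + \<alpha>) * a) * x $ 3) *s (ebasis 2 \<otimes>\<^sub>t ebasis 2)"
  by (auto simp: vec_eq_iff coproduct_def tensor_map_def r1_def tensor_def sum_3 axis_def
      Lmul_def Rmul_def hprod_def algebra_simps)

text \<open>The same computation with \<open>ebasis 3\<close> as the contributing vector, which
  brings in \<open>x $ 1\<close> and reverses the sign.\<close>

lemma coproduct_r2:
  "coproduct (hprod \<alpha>) (r2 a) x = (((1 + \<alpha>) * a) * x $ 1) *s (ebasis 2 \<otimes>\<^sub>t ebasis 2)"
  by (auto simp: vec_eq_iff coproduct_def tensor_map_def r2_def tensor_def sum_3 axis_def
      Lmul_def Rmul_def hprod_def algebra_simps)

context
  fixes \<alpha> k :: complex and r :: "complex^(3 \<times> 3)" and j :: 3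
  assumes coproduct_r: "\<And>x. coproduct (hprod \<alpha>) r x = (k * x $ j) *s (ebasis 2 \<otimes>\<^sub>t ebasis 2)"
begin

lemma bilinear_hcirc: "bilinear_product dscale (hcirc \<alpha> r)"
  by (auto simp: bilinear_product_iff vector_space_dscale hcirc_eq[OF coproduct_r] algebra_simps
      intro!: cdual_eqI)

text \<open>The factors enter only through the coordinates 1, 3 and j of their vectors and the
  values of their functionals at \<open>ebasis 2\<close>. For j \<noteq> 2 all of these vanish on
  the right-hand side, so a product multiplied by anything is zero.\<close>

lemma hbowtie_eq:
  "hbowtie \<alpha> r (x, a) (y, b) =
    ((x $ 1 * y $ 3 + \<alpha> * (x $ 3 * y $ 1) + k * (dapp a (ebasis 2) * y $ j + dapp b (ebasis 2) * x $ j))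
       *s ebasis 2,
     dscale (k * (dapp a (ebasis 2) * dapp b (ebasis 2))) (dbasis j)
       + dscale (x $ 3 * dapp b (ebasis 2) + \<alpha> * (y $ 3 * dapp a (ebasis 2))) (dbasis 1)
       + dscale (\<alpha> * (x $ 1 * dapp b (ebasis 2)) + y $ 1 * dapp a (ebasis 2)) (dbasis 3))"
  by (auto simp: hbowtie_def bowtie_product_def dapp_Rcodual[OF bilinear_hcirc]
      dapp_Lcodual[OF bilinear_hcirc] dapp_Rdual[OF bilinear_hprod] dapp_Ldual[OF bilinear_hprod]
      hcirc_eq[OF coproduct_r] hprod_def algebra_simps intro!: vec_eq_dappI cdual_eqI)

lemma double_construction_hbowtie:
  assumes "j \<noteq> 2"
  shows "double_construction (hprod \<alpha>) (hcirc \<alpha> r) (hbowtie \<alpha> r)"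
  unfolding hbowtie_def
proof (rule double_construction_bowtie_product[OF assoc_algebra_hprod])
  show "assoc_algebra dscale (hcirc \<alpha> r)"
    \<comment> \<open>For j \<noteq> 2, \<open>dbasis j\<close> is zero at \<open>ebasis 2\<close>,
      so both bracketings of a triple product vanish.\<close>
    using assms
    by (auto simp: assoc_algebra_def vector_space_dscale bilinear_hcirc hcirc_eq[OF coproduct_r]
        axis_def intro!: cdual_eqI)
  show "bowtie_product (hprod \<alpha>) (hcirc \<alpha> r) (bowtie_product (hprod \<alpha>) (hcirc \<alpha> r) u v) w =
      bowtie_product (hprod \<alpha>) (hcirc \<alpha> r) u (bowtie_product (hprod \<alpha>) (hcirc \<alpha> r) v w)" for u v w
    using assms
    by (cases u; cases v; cases w)
      (simp add: hbowtie_eq[unfolded hbowtie_def] axis_def)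
qed

end

lemma dbasis_eq_iff: "dbasis i = dbasis j \<longleftrightarrow> i = j"
  by (metis dapp_dbasis_ebasis zero_neq_one)

text \<open>Decides equality of keys, so that \<open>map_of\<close> can be evaluated on the product
  tables.\<close>

lemma distinct_basis:
  "E i = E j \<longleftrightarrow> i = j" "Es i = Es j \<longleftrightarrow> i = j" "E i \<noteq> Es j" "Es j \<noteq> E i"
  by (auto simp: E_def Es_def dbasis_eq_iff axis_eq_axis)

theorem theorem3p9:
  fixes \<alpha> a12 a23 :: complex
  assumes "\<alpha> \<noteq> 1"
  shows
    "double_construction (hprod \<alpha>) (hcirc \<alpha> (r1 a12)) (hbowtie \<alpha> (r1 a12)) \<and>
     has_product_table (range E \<union> range Es) (hbowtie \<alpha> (r1 a12))
       [((E 1, E 3), E 2),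
        ((E 3, E 1), \<alpha> \<cdot> E 2),
        ((Es 2, E 1), Es 3),
        ((E 1, Es 2), \<alpha> \<cdot> Es 3),
        ((Es 2, Es 2), (- (1 + \<alpha>) * a12) \<cdot> Es 3),
        ((E 3, Es 2), Es 1 - ((\<alpha> + 1) * a12) \<cdot> E 2),
        ((Es 2, E 3), \<alpha> \<cdot> Es 1 - ((\<alpha> + 1) * a12) \<cdot> E 2)] \<and>
     double_construction (hprod \<alpha>) (hcirc \<alpha> (r2 a23)) (hbowtie \<alpha> (r2 a23)) \<and>
     has_product_table (range E \<union> range Es) (hbowtie \<alpha> (r2 a23))
       [((E 1, E 3), E 2),
        ((E 3, E 1), \<alpha> \<cdot> E 2),
        ((E 3, Es 2), Es 1),
        ((Es 2, E 3), \<alpha> \<cdot> Es 1),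
        ((Es 2, Es 2), ((1 + \<alpha>) * a23) \<cdot> Es 1),
        ((E 1, Es 2), \<alpha> \<cdot> Es 3 + ((1 + \<alpha>) * a23) \<cdot> E 2),
        ((Es 2, E 1), Es 3 + ((1 + \<alpha>) * a23) \<cdot> E 2)]"
proof (intro conjI)
  \<comment> \<open>Listing the basis turns each table into 36 concrete products.\<close>
  have basis: "range E \<union> range Es = {E 1, E 2, E 3, Es 1, Es 2, Es 3}"
    by (auto simp: UNIV_3)
  show "double_construction (hprod \<alpha>) (hcirc \<alpha> (r1 a12)) (hbowtie \<alpha> (r1 a12))"
    \<comment> \<open>Here j = 3, while the second tensor has j = 1; what remains is j \<noteq> 2 in
      the index type.\<close>
    by (rule double_construction_hbowtie[OF coproduct_r1]) simp
  show "double_construction (hprod \<alpha>) (hcirc \<alpha> (r2 a23)) (hbowtie \<alpha> (r2 a23))"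
    by (rule double_construction_hbowtie[OF coproduct_r2]) simp
  show "has_product_table (range E \<union> range Es) (hbowtie \<alpha> (r1 a12))
       [((E 1, E 3), E 2),
        ((E 3, E 1), \<alpha> \<cdot> E 2),
        ((Es 2, E 1), Es 3),
        ((E 1, Es 2), \<alpha> \<cdot> Es 3),
        ((Es 2, Es 2), (- (1 + \<alpha>) * a12) \<cdot> Es 3),
        ((E 3, Es 2), Es 1 - ((\<alpha> + 1) * a12) \<cdot> E 2),
        ((Es 2, E 3), \<alpha> \<cdot> Es 1 - ((\<alpha> + 1) * a12) \<cdot> E 2)]"
    unfolding has_product_table_def basis
    \<comment> \<open>The first call performs the table lookups; the second compares each entry, or
      0 for an unlisted pair, with \<open>hbowtie_eq\<close> componentwise.\<close>
    by (simp add: distinct_basis)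
       (auto simp: E_def Es_def hbowtie_eq[OF coproduct_r1] sum_scale_def zero_prod_def
        axis_def vec_eq_iff algebra_simps intro!: cdual_eqI)
  show "has_product_table (range E \<union> range Es) (hbowtie \<alpha> (r2 a23))
       [((E 1, E 3), E 2),
        ((E 3, E 1), \<alpha> \<cdot> E 2),
        ((E 3, Es 2), Es 1),
        ((Es 2, E 3), \<alpha> \<cdot> Es 1),
        ((Es 2, Es 2), ((1 + \<alpha>) * a23) \<cdot> Es 1),
        ((E 1, Es 2), \<alpha> \<cdot> Es 3 + ((1 + \<alpha>) * a23) \<cdot> E 2),
        ((Es 2, E 1), Es 3 + ((1 + \<alpha>) * a23) \<cdot> E 2)]"
    unfolding has_product_table_def basis
    by (simp add: distinct_basis)
       (auto simp: E_def Es_def hbowtie_eq[OF coproduct_r2] sum_scale_def zero_prod_def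
        axis_def vec_eq_iff algebra_simps intro!: cdual_eqI)
qed

end
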